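(* Let $d\ge 2$. Every spherical convex body $W\subset S^d$ of constant width $w$ is of constant diameter $w$. Every spherical convex body $W\subset S^d$ of constant diameter $w\geq\frac{\pi}{2}$ is of constant width $w$.
   Context: $S^d$ is the unit sphere in $E^{d+1}$ and $|ab|$ is the spherical (geodesic) distance. Diameter is taken with respect to this distance. For non-antipodal $a,b$, the arc $ab$ is the shorter part of the great circle through $a,b$. A set $C\subset S^d$ is convex if it contains no pair of antipodes and $ab\subset C$ for all $a,b\in C$. A convex body is a closed convex set with non-empty interior. A convex body $W$ is of constant diameter $w$ if its diameter equals $w$ and for every boundary point $p$ of $W$ there exists $p'\in W$ such that $|pp'|=w$. A hemisphere is the set of points at distance at most $\frac{\pi}{2}$ from a point (its center). A hemisphere $K$ supports $C$ if $C\subset K$ and $\mathrm{bd}(C)\cap\mathrm{bd}(K)\neq\emptyset$. If hemispheres $G,H$ are different and not opposite (centers not antipodal), $L=G\cap H$ is a lune, bounded by the $(d-1)$-dimensional hemispheres $\mathrm{bd}(G)\cap H$ and $\mathrm{bd}(H)\cap G$. A $(d-1)$-dimensional hemisphere is a ball of radius $\frac{\pi}{2}$ within a $(d-1)$-dimensional great sphere, around a point called its center. The thickness $\Delta(L)$ is the spherical distance between the centers of the two $(d-1)$-dimensional hemispheres bounding $L$. For a hemisphere $K$ supporting $C$, $\mathrm{width}_K(C)$ is the minimum of $\Delta(K\cap K')$ over all hemispheres $K'$ supporting $C$ for which $K\cap K'$ is a lune. A convex body $W$ is of constant width $w$ if $\mathrm{width}_K(W)=w$ for every hemisphere $K$ supporting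 $W$. *)

theory Defs
  imports "HOL-Analysis.Analysis"
begin

text \<open>The sphere \<open>S\<^sup>d\<close> is \<open>sphere 0 1\<close> in a Euclidean space of dimension \<open>d + 1\<close>. Interior, boundary
  and closedness of its subsets are taken in the subspace topology.\<close>

abbreviation sphere_top :: "'a::euclidean_space topology" where
  "sphere_top \<equiv> top_of_set (sphere 0 1)"

definition sdist :: "'a::euclidean_space \<Rightarrow> 'a \<Rightarrow> real" where
  "sdist a b = arccos (a \<bullet> b)"

definition sdiameter :: "'a::euclidean_space set \<Rightarrow> real" where
  "sdiameter C = (SUP (a, b) \<in> C \<times> C. sdist a b)"

text \<open>For non-antipodal \<open>a\<close>, \<open>b\<close> on the sphere, the shorter part of the great circle through them is
  the radial projection of the chord from \<open>a\<close> to \<open>b\<close> (\<open>sgn x\<close> is \<open>x\<close> divided by its norm).\<close>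

definition sarc :: "'a::euclidean_space \<Rightarrow> 'a \<Rightarrow> 'a set" where
  "sarc a b = sgn ` closed_segment a b"

definition sconvex :: "'a::euclidean_space set \<Rightarrow> bool" where
  "sconvex C \<longleftrightarrow> C \<subseteq> sphere 0 1 \<and> (\<forall>a\<in>C. - a \<notin> C) \<and> (\<forall>a\<in>C. \<forall>b\<in>C. sarc a b \<subseteq> C)"

definition sconvex_body :: "'a::euclidean_space set \<Rightarrow> bool" where
  "sconvex_body C \<longleftrightarrow> sconvex C \<and> closedin sphere_top C \<and> sphere_top interior_of C \<noteq> {}"

definition constant_diameter :: "'a::euclidean_space set \<Rightarrow> real \<Rightarrow> bool" where
  "constant_diameter W w \<longleftrightarrow> sconvex_body W \<and> sdiameter W = w \<and>
     (\<forall>p \<in> sphere_top frontier_of W. \<exists>p'\<in>W. sdist p p' = w)"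

definition hemisphere_at :: "'a::euclidean_space \<Rightarrow> 'a set" where
  "hemisphere_at c = {x \<in> sphere 0 1. sdist c x \<le> pi / 2}"

definition hemisphere :: "'a::euclidean_space set \<Rightarrow> bool" where
  "hemisphere K \<longleftrightarrow> (\<exists>c \<in> sphere 0 1. K = hemisphere_at c)"

definition supports :: "'a::euclidean_space set \<Rightarrow> 'a set \<Rightarrow> bool" where
  "supports K C \<longleftrightarrow> hemisphere K \<and> C \<subseteq> K \<and>
     (sphere_top frontier_of C) \<inter> (sphere_top frontier_of K) \<noteq> {}"

definition opposite :: "'a::euclidean_space set \<Rightarrow> 'a set \<Rightarrow> bool" where
  "opposite G H \<longleftrightarrow> (\<exists>c \<in> sphere 0 1. G = hemisphere_at c \<and> H = hemisphere_at (- c))"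

definition forms_lune :: "'a::euclidean_space set \<Rightarrow> 'a set \<Rightarrow> bool" where
  "forms_lune G H \<longleftrightarrow> hemisphere G \<and> hemisphere H \<and> G \<noteq> H \<and> \<not> opposite G H"

text \<open>\<open>X\<close> is a \<open>(d - 1)\<close>-dimensional hemisphere with center \<open>c\<close>. The \<open>(d - 1)\<close>-dimensional great
  spheres are the sections of \<open>S\<^sup>d\<close> by linear subspaces \<open>T\<close> of dimension \<open>d\<close>; spherical distance
  within such a great sphere is the restriction of that of \<open>S\<^sup>d\<close>.\<close>

definition is_subhemisphere_at :: "'a::euclidean_space \<Rightarrow> 'a set \<Rightarrow> bool" where
  "is_subhemisphere_at c X \<longleftrightarrow> (\<exists>T. subspace T \<and> dim T + 1 = DIM('a) \<and>
     c \<in> sphere 0 1 \<inter> T \<and> X = {x \<in> sphere 0 1 \<inter> T. sdist c x \<le> pi / 2})"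

definition subhemisphere_center :: "'a::euclidean_space set \<Rightarrow> 'a" where
  "subhemisphere_center X = (THE c. is_subhemisphere_at c X)"

text \<open>The thickness of the lune \<open>G \<inter> H\<close>, given by its two hemispheres; meaningful only if
  \<open>forms_lune G H\<close>.\<close>

definition lune_thickness :: "'a::euclidean_space set \<Rightarrow> 'a set \<Rightarrow> real" where
  "lune_thickness G H =
     sdist (subhemisphere_center ((sphere_top frontier_of G) \<inter> H))
           (subhemisphere_center ((sphere_top frontier_of H) \<inter> G))"

definition swidth :: "'a::euclidean_space set \<Rightarrow> 'a set \<Rightarrow> real" where
  "swidth K C = (LEAST t. \<exists>K'. supports K' C \<and> forms_lune K K' \<and> t = lune_thickness K K')"

definition constant_width :: "'a::euclidean_space set \<Rightarrow> real \<Rightarrow> bool" where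
  "constant_width W w \<longleftrightarrow> sconvex_body W \<and> (\<forall>K. supports K W \<longrightarrow> swidth K W = w)"

end

theory Submission imports Defs begin

text \<open>Let \<open>U\<close> be the set of centers of hemispheres that contain the body \<open>W\<close> (\<open>polar W\<close> below). Hemispheres
  with centers \<open>c\<close>, \<open>c'\<close> form a lune of thickness \<open>pi\<close> minus the distance of \<open>c\<close> and \<open>c'\<close>, and a hemisphere
  supports \<open>W\<close> exactly if its center is on the boundary of \<open>U\<close>. Hence \<open>W\<close> has constant width \<open>w\<close> if and only
  if \<open>U\<close> has constant diameter \<open>pi - w\<close> (\<open>constant_width_iff\<close>). Since \<open>W\<close> is in turn the polar set of \<open>U\<close>
  (\<open>bipolar\<close>), both implications follow from one statement that is symmetric in the two sets: if \<open>V\<close> has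
  constant diameter \<open>\<delta>\<close>, then its polar set has constant diameter \<open>pi - \<delta>\<close>
  (\<open>polar_constant_diameter\<close>). Writing \<open>k = cos \<delta>\<close>, the claims are that \<open>c \<bullet> c' \<ge> - k\<close> for all centers and that
  every boundary center \<open>c\<close> has some \<open>c'\<close> with equality.

  The basic tool is a first-order condition (\<open>farthest_normal\<close>): if \<open>p\<close>, \<open>q\<close> are at maximal distance
  in \<open>V\<close>, then the hemispheres orthogonal to the arc \<open>pq\<close> at its ends contain \<open>V\<close>, and their centers
  have distance \<open>pi - \<delta>\<close>. The same condition for the polar set shows that a thinnest lune around \<open>V\<close> has
  the centers of both its bounding hemispheres in \<open>V\<close>.

  If \<open>\<delta> > pi / 2\<close>, a lune thinner than \<open>\<delta>\<close> contains no point at distance \<open>\<delta>\<close> from such a center, which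
  bounds the diameter of the polar set; and a diametral pair \<open>p\<close>, \<open>q\<close> of \<open>V\<close> shows that the bound is attained at
  every normal \<open>c\<close> of \<open>V\<close> at \<open>p\<close>, because \<open>c \<bullet> q \<le> sin \<delta>\<close>.

  If \<open>\<delta> \<le> pi / 2\<close>, balls of radius \<open>\<delta>\<close> are convex, and \<open>V\<close> is the intersection of the balls of radius \<open>\<delta>\<close>
  around its points (\<open>mem_V_if_within_diameter\<close>). It follows that \<open>V\<close> contains the point at distance
  \<open>\<delta>\<close> from \<open>p\<close> along every inner normal at \<open>p\<close>, not only along one of them (\<open>opposite_point_mem_V\<close>). That
  point gives both the bound and its attainment.\<close>

section \<open>Unit vectors and polar sets\<close>

text \<open>The centers of the hemispheres that contain \<open>C\<close>: the unit vectors of the dual cone.\<close>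

definition polar :: "'a::euclidean_space set \<Rightarrow> 'a set" where
  "polar C = {x \<in> sphere 0 1. \<forall>c\<in>C. 0 \<le> c \<bullet> x}"

lemma inner_self_sphere: "x \<in> sphere 0 1 \<Longrightarrow> x \<bullet> x = 1"
  by (simp add: dot_square_norm)

lemma inner_eq_1_sphere:
  assumes "x \<in> sphere 0 1" "y \<in> sphere 0 1" "x \<bullet> y = 1"
  shows "x = y"
proof -
  have "(x - y) \<bullet> (x - y) = 0"
    using assms inner_self_sphere[of x] inner_self_sphere[of y]
    by (simp add: inner_diff_left inner_diff_right inner_commute)
  then show ?thesis by simp
qed

lemma inner_le_1_sphere:
  assumes "x \<in> sphere 0 1" "y \<in> sphere 0 1"
  shows "x \<bullet> y \<le> 1" "-1 \<le> x \<bullet> y"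
  using Cauchy_Schwarz_ineq2[of x y] assms by auto

lemma bessel_two:
  assumes "c \<in> sphere 0 1" "p \<in> sphere 0 1" "x \<in> sphere 0 1" "c \<bullet> p = 0"
  shows "(c \<bullet> x)\<^sup>2 + (p \<bullet> x)\<^sup>2 \<le> 1"
proof -
  let ?r = "x - (c \<bullet> x) *\<^sub>R c - (p \<bullet> x) *\<^sub>R p"
  have "?r \<bullet> ?r = 1 - (c \<bullet> x)\<^sup>2 - (p \<bullet> x)\<^sup>2"
    using assms(4) inner_self_sphere[OF assms(1)] inner_self_sphere[OF assms(2)]
      inner_self_sphere[OF assms(3)]
    by (simp add: inner_diff_left inner_diff_right inner_commute power2_eq_square algebra_simps)
  then show ?thesis using inner_ge_zero[of ?r] by linarith
qed

lemma sgn_mem_polar: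
  assumes "x \<noteq> 0" "\<And>c. c \<in> C \<Longrightarrow> 0 \<le> c \<bullet> x"
  shows "sgn x \<in> polar C"
  using assms by (simp add: polar_def norm_sgn) (simp add: sgn_div_norm)

lemma inner_sgn_left: "sgn x \<bullet> y = (x \<bullet> y) / norm x" for x :: "'a::real_inner"
  by (simp add: sgn_div_norm divide_inverse)

lemma le_inner_sgn_iff: "x \<noteq> 0 \<Longrightarrow> k \<le> sgn x \<bullet> y \<longleftrightarrow> k * norm x \<le> x \<bullet> y"
  for x :: "'a::real_inner"
  by (simp add: inner_sgn_left pos_le_divide_eq)

lemma compact_polar: "compact (polar C)"
proof -
  have "polar C = sphere 0 1 \<inter> (\<Inter>c\<in>C. {x. 0 \<le> c \<bullet> x})" by (auto simp: polar_def)
  moreover have "closed (\<Inter>c\<in>C. {x. 0 \<le> c \<bullet> x})"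
    by (intro closed_INT ballI closed_Collect_le continuous_intros)
  ultimately show ?thesis by (simp add: compact_Int_closed)
qed

lemma polar_sphere: "x \<in> polar C \<Longrightarrow> x \<in> sphere 0 1"
  by (simp add: polar_def)

lemma compact_inner_lower_bound:
  assumes "compact C" "\<And>c. c \<in> C \<Longrightarrow> 0 < c \<bullet> p"
  obtains \<mu> where "0 < \<mu>" "\<And>c. c \<in> C \<Longrightarrow> \<mu> \<le> c \<bullet> p"
proof (cases "C = {}")
  case True
  then show ?thesis using that[of 1] by auto
next
  case False
  have "continuous_on C (\<lambda>c. c \<bullet> p)" by (intro continuous_intros)
  from continuous_attains_inf[OF assms(1) False this] show ?thesis
    using that assms(2) by blast
qed

text \<open>By compactness, a point that is strictly on the positive side of every \<open>c \<in> C\<close> stays so under small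
  perturbations. Applied to \<open>C = {c}\<close> this gives the boundary of a hemisphere, and applied to the polar
  set of a convex body it gives the boundary of that body.\<close>

lemma frontier_of_polar:
  fixes C :: "'a::euclidean_space set"
  assumes "compact C" "C \<subseteq> sphere 0 1"
  shows "sphere_top frontier_of (polar C) = {p \<in> polar C. \<exists>c\<in>C. c \<bullet> p = 0}"
proof -
  have "closedin sphere_top (polar C)"
    using compact_imp_closed[OF compact_polar[of C]]
    by (auto simp: closedin_closed polar_def intro!: exI[of _ "polar C"])
  then have fr: "sphere_top frontier_of (polar C) = polar C - sphere_top interior_of (polar C)"
    by (simp add: frontier_of_def closure_of_closedin)
  have "p \<notin> sphere_top interior_of (polar C)"
    if p: "p \<in> polar C" and c: "c \<in> C" "c \<bullet> p = 0" for p c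
  proof
    assume "p \<in> sphere_top interior_of (polar C)"
    then obtain T where T: "openin sphere_top T" "p \<in> T" "T \<subseteq> polar C"
      by (auto simp: interior_of_def)
    then obtain e where e: "e > 0" "ball p e \<inter> sphere 0 1 \<subseteq> T"
      by (meson openin_contains_ball)
    have ps: "norm p = 1" using p by (simp add: polar_def)
    have cs: "c \<bullet> c = 1" using c assms(2) inner_self_sphere by blast
    \<comment> \<open>Pushing \<open>p\<close> slightly against \<open>c\<close> leaves the set at once, so \<open>p\<close> is not interior.\<close>
    have "((\<lambda>t. sgn (p - t *\<^sub>R c)) \<longlongrightarrow> sgn (p - 0 *\<^sub>R c)) (at_right 0)"
      using ps by (intro tendsto_intros) auto
    then have "((\<lambda>t. sgn (p - t *\<^sub>R c)) \<longlongrightarrow> p) (at_right 0)"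
      using ps by (simp add: sgn_div_norm)
    from tendstoD[OF this e(1)] have "\<forall>\<^sub>F t in at_right 0. dist (sgn (p - t *\<^sub>R c)) p < e" .
    moreover have "\<forall>\<^sub>F t in at_right (0::real). 0 < t"
      by (simp add: eventually_at_right_less)
    ultimately have "\<forall>\<^sub>F t in at_right (0::real). 0 < t \<and> dist (sgn (p - t *\<^sub>R c)) p < e"
      by eventually_elim simp
    then obtain t where t: "0 < t" "dist (sgn (p - t *\<^sub>R c)) p < e"
      using eventually_happens trivial_limit_at_right_real by blast
    let ?y = "p - t *\<^sub>R c"
    have neg: "c \<bullet> ?y < 0" using t c cs by (simp add: inner_diff_right)
    then have "?y \<noteq> 0" by auto
    then have "sgn ?y \<in> polar C"
      using t e T by (auto simp: norm_sgn dist_commute)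
    then have "0 \<le> c \<bullet> sgn ?y" using c by (auto simp: polar_def)
    moreover have "c \<bullet> sgn ?y < 0"
      using neg \<open>?y \<noteq> 0\<close> by (simp add: sgn_div_norm mult_pos_neg divide_neg_pos)
    ultimately show False by simp
  qed
  moreover have "p \<in> sphere_top interior_of (polar C)"
    if p: "p \<in> polar C" and pos: "\<forall>c\<in>C. c \<bullet> p \<noteq> 0" for p
  proof -
    have "\<And>c. c \<in> C \<Longrightarrow> 0 < c \<bullet> p" using p pos by (force simp: polar_def)
    then obtain \<mu> where \<mu>: "0 < \<mu>" "\<And>c. c \<in> C \<Longrightarrow> \<mu> \<le> c \<bullet> p"
      using compact_inner_lower_bound[OF assms(1)] by blast
    have "0 \<le> c \<bullet> y" if y: "y \<in> ball p \<mu>" and c: "c \<in> C" for y c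
    proof -
      have "\<bar>c \<bullet> (p - y)\<bar> \<le> norm c * norm (p - y)" by (rule Cauchy_Schwarz_ineq2)
      also have "\<dots> \<le> \<mu>" using c assms(2) y by (auto simp: dist_norm)
      finally show ?thesis using \<mu>(2)[OF c] by (simp add: inner_diff_right)
    qed
    then have "ball p \<mu> \<inter> sphere 0 1 \<subseteq> polar C" by (auto simp: polar_def)
    moreover have "openin sphere_top (ball p \<mu> \<inter> sphere 0 1)"
      using openin_open_Int[of "ball p \<mu>" "sphere 0 1"] by (simp add: Int_commute)
    moreover have "p \<in> ball p \<mu> \<inter> sphere 0 1" using p \<mu> by (simp add: polar_def)
    ultimately show ?thesis by (force simp: interior_of_def)
  qed
  ultimately show ?thesis unfolding fr by blast
qed

section \<open>Mutually polar sets\<close>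

text \<open>A convex body and the set of centers of its containing hemispheres, in a form that is symmetric in the
  two sets, so that every lemma about \<open>V\<close> also holds for \<open>U\<close>. The boundary of \<open>V\<close> consists of the
  \<open>p \<in> V\<close> with \<open>c \<bullet> p = 0\<close> for some \<open>c \<in> U\<close>. An interior point of one set rules out antipodes in the
  other.\<close>

locale polar_pair =
  fixes V U :: "'a::euclidean_space set"
  assumes V_eq: "V = polar U"
    and U_eq: "U = polar V"
    and V_interior: "\<exists>z\<in>V. \<forall>c\<in>U. 0 < c \<bullet> z"
    and U_interior: "\<exists>b\<in>U. \<forall>x\<in>V. 0 < x \<bullet> b"
    and dim2: "2 \<le> DIM('a)"
begin

lemma flip: "polar_pair U V"
  using V_eq U_eq V_interior U_interior dim2 by unfold_locales auto

lemma V_sphere: "x \<in> V \<Longrightarrow> x \<in> sphere 0 1" and U_sphere: "c \<in> U \<Longrightarrow> c \<in> sphere 0 1"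
  using V_eq U_eq polar_sphere by blast+

lemma U_V_nonneg: "c \<in> U \<Longrightarrow> x \<in> V \<Longrightarrow> 0 \<le> c \<bullet> x"
  using V_eq by (auto simp: polar_def)

lemma compact_V: "compact V"
  using V_eq compact_polar by metis

lemma inner_gt_minus_1:
  assumes "x \<in> V" "y \<in> V"
  shows "-1 < x \<bullet> y"
proof -
  obtain b where "b \<in> U" "\<forall>x\<in>V. 0 < x \<bullet> b" using U_interior by blast
  then have "(x + y) \<bullet> b > 0" using assms by (simp add: inner_add_left add_pos_pos)
  then have "x + y \<noteq> 0" by auto
  then have "(x + y) \<bullet> (x + y) > 0" by simp
  then show ?thesis
    using inner_self_sphere[OF V_sphere] assms
    by (simp add: inner_add_left inner_add_right inner_commute)
qed

text \<open>If \<open>V\<close> had only the point \<open>x\<close>, then \<open>U\<close> would be a hemisphere and so contain antipodes.\<close>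

lemma V_other_point:
  assumes "x \<in> V"
  shows "\<exists>y\<in>V. y \<noteq> x"
proof (rule ccontr)
  assume "\<not> ?thesis"
  then have V: "V = {x}" using assms by blast
  obtain v where v: "v \<noteq> 0" "orthogonal x v"
    by (rule orthogonal_to_vector_exists[OF dim2])
  then have "sgn v \<in> polar V" "sgn (- v) \<in> polar V"
    unfolding V by (auto intro!: sgn_mem_polar simp: orthogonal_def)
  then have "-1 < sgn v \<bullet> sgn (- v)"
    using polar_pair.inner_gt_minus_1[OF flip] U_eq by blast
  moreover have "sgn v \<bullet> sgn (- v) = - (sgn v \<bullet> sgn v)" by (simp add: sgn_minus)
  moreover have "sgn v \<bullet> sgn v = 1" using v by (simp add: dot_square_norm norm_sgn)
  ultimately show False by simp
qed

lemma inner_lt_1: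
  assumes "x \<in> V" "y \<in> V" "x \<noteq> y"
  shows "x \<bullet> y < 1"
  using inner_eq_1_sphere[OF V_sphere V_sphere, of x y] inner_le_1_sphere(1)[OF V_sphere V_sphere, of x y] assms
  by force

text \<open>First-order optimality: if \<open>a\<close> is a point of \<open>V\<close> farthest from \<open>b\<close>, then moving from \<open>a\<close> towards any
  \<open>y\<close> in \<open>V\<close> cannot increase the distance from \<open>b\<close>. This needs no convexity of the ball around \<open>b\<close>, so
  it holds for distances above \<open>pi / 2\<close> as well.\<close>

lemma nonneg_on_V_if_farthest:
  assumes a: "a \<in> V" and b: "b \<in> V"
    and far: "\<And>y. y \<in> V \<Longrightarrow> a \<bullet> b \<le> y \<bullet> b" and y: "y \<in> V"
  shows "0 \<le> (b - (a \<bullet> b) *\<^sub>R a) \<bullet> y"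
proof (rule ccontr)
  define k where "k = a \<bullet> b"
  define s where "s = y \<bullet> b - k * (a \<bullet> y)"
  assume "\<not> ?thesis"
  then have s: "s < 0" by (simp add: s_def k_def inner_diff_left inner_diff_right inner_commute)
  have k1: "\<bar>k\<bar> \<le> 1"
    using inner_le_1_sphere[OF V_sphere[OF a] V_sphere[OF b]] by (simp add: k_def abs_le_iff)
  have aa: "a \<bullet> a = 1" and yy: "y \<bullet> y = 1" using a y V_sphere inner_self_sphere by blast+
  \<comment> \<open>Any \<open>t\<close> with \<open>0 < t < - 2 * s\<close> gives a contradiction below.\<close>
  define t where "t = - s"
  have t: "0 < t" using s by (simp add: t_def)
  let ?z = "a + t *\<^sub>R y"
  have n1: "1 + t * (a \<bullet> y) \<le> norm ?z"
    using norm_cauchy_schwarz[of a ?z] V_sphere[OF a] by (simp add: inner_add_right aa)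
  have "0 \<le> (norm ?z - 1)\<^sup>2" by simp
  moreover have "(norm ?z)\<^sup>2 = 1 + 2 * t * (a \<bullet> y) + t\<^sup>2"
    unfolding power2_norm_eq_inner
    by (simp add: inner_add_left inner_add_right aa yy inner_commute power2_eq_square algebra_simps)
  ultimately have n2: "norm ?z \<le> 1 + t * (a \<bullet> y) + t\<^sup>2 / 2"
    by (simp add: power2_eq_square algebra_simps)
  have "k * (1 + t * (a \<bullet> y)) - t\<^sup>2 / 2 \<le> k * norm ?z"
  proof (cases "0 \<le> k")
    case True
    from mult_left_mono[OF n1 this] show ?thesis using zero_le_power2[of t] by linarith
  next
    case False
    then have "k * (1 + t * (a \<bullet> y) + t\<^sup>2 / 2) \<le> k * norm ?z"
      using mult_left_mono_neg[OF n2, of k] by simp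
    moreover have "- (t\<^sup>2 / 2) \<le> k * (t\<^sup>2 / 2)"
      using k1 mult_right_mono[of "-1" k "t\<^sup>2 / 2"] by simp
    ultimately show ?thesis by (simp add: algebra_simps)
  qed
  moreover have "k * norm ?z \<le> ?z \<bullet> b"
  proof (cases "?z = 0")
    case False
    have "sgn ?z \<in> V" unfolding V_eq
      using False t U_V_nonneg[OF _ a] U_V_nonneg[OF _ y]
      by (intro sgn_mem_polar) (auto simp: inner_add_right)
    from far[OF this] show ?thesis using le_inner_sgn_iff[OF False] by (simp add: k_def)
  next
    case True
    then show ?thesis by (metis inner_zero_left mult_zero_right norm_zero order_refl)
  qed
  ultimately have "- (t\<^sup>2 / 2) \<le> t * s"
    by (simp add: inner_add_left s_def k_def algebra_simps)
  then have "t\<^sup>2 / 2 \<le> 0" using t by (simp add: t_def power2_eq_square)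
  then show False using t by (simp add: zero_less_power2 not_le[symmetric])
qed

text \<open>The hemisphere orthogonal at \<open>a\<close> to the arc from a farthest point \<open>a\<close> to \<open>b\<close> supports \<open>V\<close> at \<open>a\<close>.\<close>

lemma farthest_normal:
  assumes a: "a \<in> V" and b: "b \<in> V" and "a \<bullet> b < 1"
    and far: "\<And>y. y \<in> V \<Longrightarrow> a \<bullet> b \<le> y \<bullet> b"
  defines "c \<equiv> (b - (a \<bullet> b) *\<^sub>R a) /\<^sub>R sqrt (1 - (a \<bullet> b)\<^sup>2)"
  shows "c \<in> U" and "c \<bullet> a = 0"
proof -
  let ?d = "b - (a \<bullet> b) *\<^sub>R a"
  have aa: "a \<bullet> a = 1" and bb: "b \<bullet> b = 1" using a b V_sphere inner_self_sphere by blast+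
  have n: "norm ?d = sqrt (1 - (a \<bullet> b)\<^sup>2)"
    by (simp add: norm_eq_sqrt_inner inner_diff_left inner_diff_right aa bb inner_commute
        power2_eq_square)
  have "(a \<bullet> b)\<^sup>2 < 1"
    using assms(3) inner_gt_minus_1[OF a b] by (simp add: abs_square_less_1 abs_less_iff)
  then have "?d \<noteq> 0" using n by auto
  then have "sgn ?d \<in> U" unfolding U_eq
    using nonneg_on_V_if_farthest[OF a b far] by (intro sgn_mem_polar) (auto simp: inner_commute)
  then show "c \<in> U" by (simp add: c_def sgn_div_norm n)
  show "c \<bullet> a = 0" by (simp add: c_def inner_diff_left inner_diff_right aa inner_commute)
qed

lemma exists_farthest:
  assumes "x \<in> V"
  obtains a where "a \<in> V" "\<And>y. y \<in> V \<Longrightarrow> a \<bullet> x \<le> y \<bullet> x" "a \<bullet> x < 1"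
proof -
  have "continuous_on V (\<lambda>y. y \<bullet> x)" by (intro continuous_intros)
  from continuous_attains_inf[OF compact_V _ this] assms
  obtain a where a: "a \<in> V" "\<And>y. y \<in> V \<Longrightarrow> a \<bullet> x \<le> y \<bullet> x" by blast
  obtain y where "y \<in> V" "y \<noteq> x" using V_other_point assms by blast
  then have "a \<bullet> x < 1" using a(2)[of y] inner_lt_1[of y x] assms by auto
  then show ?thesis using a that by blast
qed

lemma exists_diametral_pair:
  obtains a b where "a \<in> V" "b \<in> V" "\<And>x y. x \<in> V \<Longrightarrow> y \<in> V \<Longrightarrow> a \<bullet> b \<le> x \<bullet> y"
proof -
  have "continuous_on (V \<times> V) (\<lambda>q. fst q \<bullet> snd q)"
    by (rule continuous_on_inner[OF continuous_on_fst[OF continuous_on_id]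
          continuous_on_snd[OF continuous_on_id]])
  moreover have "V \<times> V \<noteq> {}" using V_interior by blast
  ultimately have "\<exists>p\<in>V \<times> V. \<forall>q\<in>V \<times> V. fst p \<bullet> snd p \<le> fst q \<bullet> snd q"
    by (intro continuous_attains_inf[OF compact_Times[OF compact_V compact_V]])
  then obtain p where p: "p \<in> V \<times> V" "\<forall>q\<in>V \<times> V. fst p \<bullet> snd p \<le> fst q \<bullet> snd q" ..
  show ?thesis
  proof (rule that[of "fst p" "snd p"])
    show "fst p \<in> V" "snd p \<in> V" using p(1) by auto
    show "fst p \<bullet> snd p \<le> x \<bullet> y" if "x \<in> V" "y \<in> V" for x y
      using p(2)[rule_format, of "(x, y)"] that by simp
  qed
qed

end

section \<open>The polar of a set of constant diameter\<close>

text \<open>Here \<open>k\<close> is the cosine of the diameter.\<close>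

locale constant_diameter_pair = polar_pair +
  fixes k :: real
  assumes diameter: "x \<in> V \<Longrightarrow> y \<in> V \<Longrightarrow> k \<le> x \<bullet> y"
    and partner: "p \<in> V \<Longrightarrow> c \<in> U \<Longrightarrow> c \<bullet> p = 0 \<Longrightarrow> \<exists>q\<in>V. p \<bullet> q = k"
begin

lemma k_bounds: "-1 < k" "k < 1"
proof -
  obtain x where "x \<in> V" using V_interior by blast
  obtain a where a: "a \<in> V" "\<And>y. y \<in> V \<Longrightarrow> a \<bullet> x \<le> y \<bullet> x" "a \<bullet> x < 1"
    using exists_farthest[OF \<open>x \<in> V\<close>] by blast
  show "k < 1" using diameter[OF a(1) \<open>x \<in> V\<close>] a(3) by simp
  from farthest_normal[OF a(1) \<open>x \<in> V\<close> a(3,2)]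
  obtain q where "q \<in> V" "a \<bullet> q = k" using partner[OF a(1)] by blast
  then show "-1 < k" using inner_gt_minus_1[OF a(1)] by auto
qed

lemma k_sq: "k\<^sup>2 < 1"
  using k_bounds by (simp add: abs_square_less_1 abs_less_iff)

lemma partner_normal:
  assumes "p \<in> V" "q \<in> V" "p \<bullet> q = k"
  shows "(q - k *\<^sub>R p) /\<^sub>R sqrt (1 - k\<^sup>2) \<in> U"
  using farthest_normal(1)[of p q] assms diameter k_bounds by simp

text \<open>If \<open>z\<close> were at full distance from \<open>x\<close>, the hemisphere orthogonal to the arc \<open>zx\<close> at \<open>z\<close> would support \<open>V\<close>
  there, and \<open>z\<close> would be a boundary point.\<close>

lemma interior_inner_gt:
  assumes z: "z \<in> V" "\<forall>c\<in>U. 0 < c \<bullet> z" and x: "x \<in> V"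
  shows "k < z \<bullet> x"
proof (rule ccontr)
  assume "\<not> ?thesis"
  then have eq: "z \<bullet> x = k" using diameter[OF z(1) x] by simp
  have "z \<bullet> x < 1" "\<And>y. y \<in> V \<Longrightarrow> z \<bullet> x \<le> y \<bullet> x" using eq k_bounds x diameter by auto
  from farthest_normal[OF z(1) x this] z(2) show False by force
qed

text \<open>A set of constant diameter at most \<open>pi / 2\<close> is complete: no point can be added without increasing the
  diameter. If \<open>y\<close> could be added, let \<open>p\<close> be the point where the arc from an interior point \<open>z\<close> to \<open>y\<close>
  leaves \<open>V\<close>, and \<open>q\<close> a point at full distance from \<open>p\<close>. Then \<open>y\<close> is in the closed and \<open>z\<close> in the open
  ball around \<open>q\<close> whose radius is the diameter. As \<open>0 \<le> k\<close>, this ball is convex, so \<open>p\<close> would also be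
  in the open ball.\<close>

lemma mem_V_if_within_diameter:
  assumes k0: "0 \<le> k" and y: "y \<in> sphere 0 1" and near: "\<And>x. x \<in> V \<Longrightarrow> k \<le> y \<bullet> x"
  shows "y \<in> V"
proof (rule ccontr)
  assume "y \<notin> V"
  then obtain c where c: "c \<in> U" "c \<bullet> y < 0" using y V_eq by (auto simp: polar_def not_le)
  obtain z where z: "z \<in> V" "\<forall>c\<in>U. 0 < c \<bullet> z" using V_interior by blast
  \<comment> \<open>The largest ratio \<open>r\<close> makes \<open>r *\<^sub>R z + y\<close> the point where the arc from \<open>z\<close> to \<open>y\<close> leaves \<open>V\<close>.\<close>
  define f where "f c = - (c \<bullet> y) / (c \<bullet> z)" for c
  have "continuous_on U f" unfolding f_def
    using z by (intro continuous_intros) force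
  from continuous_attains_sup[OF polar_pair.compact_V[OF flip] _ this] c
  obtain c0 where c0: "c0 \<in> U" "\<And>c. c \<in> U \<Longrightarrow> f c \<le> f c0" by blast
  define r where "r = f c0"
  have "0 < f c" using c z by (simp add: f_def divide_neg_pos)
  then have r: "0 < r" using c0(2)[OF c(1)] by (simp add: r_def)
  let ?p = "r *\<^sub>R z + y"
  have nonneg: "0 \<le> e \<bullet> ?p" if "e \<in> U" for e
  proof -
    have "0 < e \<bullet> z" using z that by blast
    moreover have "- (e \<bullet> y) / (e \<bullet> z) \<le> r" using c0(2)[OF that] by (simp add: r_def f_def)
    ultimately have "- (e \<bullet> y) \<le> r * (e \<bullet> z)" by (simp only: pos_divide_le_eq)
    then show ?thesis by (simp add: inner_add_right)
  qed
  have zero: "c0 \<bullet> ?p = 0"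
  proof -
    have "c0 \<bullet> z \<noteq> 0" using z c0(1) by force
    then show ?thesis by (simp add: r_def f_def inner_add_right inner_diff_right)
  qed
  have gt: "k * (r + 1) < ?p \<bullet> x" if "x \<in> V" for x
    using mult_strict_left_mono[OF interior_inner_gt[OF z that] r] near[OF that]
    by (simp add: inner_add_left algebra_simps)
  have "0 \<le> k * (r + 1)" using k0 r by simp
  then have p0: "?p \<noteq> 0" using gt[OF z(1)] by (metis inner_zero_left not_less)
  then have pV: "sgn ?p \<in> V" unfolding V_eq using nonneg by (intro sgn_mem_polar)
  moreover have "c0 \<bullet> sgn ?p = 0" using zero by (simp add: sgn_div_norm)
  ultimately obtain q where q: "q \<in> V" "sgn ?p \<bullet> q = k" using partner c0(1) by blast
  have "norm ?p \<noteq> 0" using p0 by simp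
  then have "?p \<bullet> q = k * norm ?p" using q(2) unfolding inner_sgn_left
    by (rule nonzero_divide_eq_eq[THEN iffD1])
  also have "\<dots> \<le> k * (r + 1)"
    using k0 norm_triangle_ineq[of "r *\<^sub>R z" y] V_sphere[OF z(1)] y r
    by (intro mult_left_mono) auto
  finally show False using gt[OF q(1)] by simp
qed

lemma inner_normal_le:
  assumes "c \<in> sphere 0 1" "p \<in> sphere 0 1" "x \<in> sphere 0 1" "c \<bullet> p = 0" "k\<^sup>2 \<le> (p \<bullet> x)\<^sup>2"
  shows "c \<bullet> x \<le> sqrt (1 - k\<^sup>2)"
  using bessel_two[OF assms(1-4)] assms(5) by (intro real_le_rsqrt) simp

text \<open>The point at distance \<open>arccos k\<close> from \<open>p\<close> along the inner normal \<open>c\<close> belongs to \<open>V\<close>, even when \<open>c\<close> is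
  only one of several normals at \<open>p\<close>. By completeness it is enough that no \<open>x\<close> in \<open>V\<close> is farther from it
  than \<open>arccos k\<close>. If \<open>x\<close> were, the circular arc of radius \<open>arccos k\<close> from \<open>p\<close> to \<open>x\<close> would first leave
  the hemisphere of \<open>c\<close>. But a point close to \<open>p\<close> on that side is within \<open>arccos k\<close> of all of \<open>V\<close>, hence
  in \<open>V\<close>, which lies in that hemisphere.\<close>

lemma opposite_point_mem_V:
  assumes k0: "0 \<le> k" and c: "c \<in> U" and p: "p \<in> V" and cp: "c \<bullet> p = 0"
  shows "k *\<^sub>R p + sqrt (1 - k\<^sup>2) *\<^sub>R c \<in> V" (is "?p' \<in> V")
proof (rule mem_V_if_within_diameter[OF k0])
  define \<sigma> where "\<sigma> = sqrt (1 - k\<^sup>2)"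
  have \<sigma>: "0 < \<sigma>" "\<sigma> \<le> 1" "\<sigma>\<^sup>2 = 1 - k\<^sup>2" using k_sq by (simp_all add: \<sigma>_def)
  have cs: "c \<in> sphere 0 1" and ps: "p \<in> sphere 0 1"
    using c p polar_pair.V_sphere[OF flip] V_sphere by blast+
  have cc: "c \<bullet> c = 1" and pp: "p \<bullet> p = 1" using cs ps inner_self_sphere by blast+
  have "?p' \<bullet> ?p' = k\<^sup>2 + \<sigma>\<^sup>2"
    using cp by (simp add: inner_add_left inner_add_right cc pp inner_commute power2_eq_square \<sigma>_def)
  then show "?p' \<in> sphere 0 1" using \<sigma>(3) by (simp add: norm_eq_sqrt_inner)
  fix x assume x: "x \<in> V"
  show "k \<le> ?p' \<bullet> x"
  proof (rule ccontr)
    assume "\<not> k \<le> ?p' \<bullet> x"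
    define g where "g = k * (1 - p \<bullet> x) - \<sigma> * (c \<bullet> x)"
    have g: "0 < g" using \<open>\<not> k \<le> ?p' \<bullet> x\<close> by (simp add: g_def \<sigma>_def inner_add_left algebra_simps)
    \<comment> \<open>The direction \<open>h\<close> is \<open>x\<close> without its component along \<open>c\<close>, tilted by \<open>\<eta>\<close> so that it points out
      of the hemisphere of \<open>c\<close>. The tilt uses up at most half of the slack \<open>g\<close>, so that moving along \<open>h\<close>
      still increases \<open>v \<bullet> y - k * norm y\<close> to first order, for every \<open>v\<close> in \<open>V\<close> at the same time.\<close>
    define \<eta> where "\<eta> = g / 2"
    define h where "h = x - (c \<bullet> x + \<eta>) *\<^sub>R c"
    have slope: "g / 2 \<le> h \<bullet> v - k * (p \<bullet> h)" if v: "v \<in> V" for v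
    proof -
      have "k\<^sup>2 \<le> (p \<bullet> v)\<^sup>2" using diameter[OF p v] k0 by (simp add: power_mono)
      then have "c \<bullet> v \<le> \<sigma>" unfolding \<sigma>_def using inner_normal_le[OF cs ps V_sphere[OF v] cp] by blast
      then have "(c \<bullet> x + \<eta>) * (c \<bullet> v) \<le> (c \<bullet> x + \<eta>) * \<sigma>"
        using U_V_nonneg[OF c x] g by (intro mult_left_mono) (auto simp: \<eta>_def)
      moreover have "\<eta> * \<sigma> \<le> \<eta>" using \<sigma> g by (simp add: \<eta>_def)
      moreover have "k \<le> x \<bullet> v" using diameter[OF x v] .
      moreover have "p \<bullet> h = p \<bullet> x" using cp by (simp add: h_def inner_diff_right inner_commute)
      moreover have "h \<bullet> v = x \<bullet> v - (c \<bullet> x + \<eta>) * (c \<bullet> v)"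
        by (simp add: h_def inner_diff_left)
      moreover have "(c \<bullet> x + \<eta>) * \<sigma> = \<sigma> * (c \<bullet> x) + \<eta> * \<sigma>" by (simp add: algebra_simps)
      moreover have "k * (1 - p \<bullet> x) = k - k * (p \<bullet> x)" by (simp add: algebra_simps)
      moreover have "k * (p \<bullet> h) = k * (p \<bullet> x)" using \<open>p \<bullet> h = p \<bullet> x\<close> by simp
      ultimately show ?thesis using g_def \<eta>_def by linarith
    qed
    \<comment> \<open>This step is short enough for the second-order error \<open>\<epsilon>\<^sup>2 * (norm h)\<^sup>2 / 2\<close> to stay below the
      first-order gain \<open>\<epsilon> * g / 2\<close>; the summand 1 covers \<open>h = 0\<close>.\<close>
    define \<epsilon> where "\<epsilon> = g / (1 + (norm h)\<^sup>2)"
    have pos: "0 < 1 + (norm h)\<^sup>2" by (simp add: add_pos_nonneg)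
    have \<epsilon>: "0 < \<epsilon>" "\<epsilon> * (norm h)\<^sup>2 \<le> g" using g pos
      by (simp_all add: \<epsilon>_def divide_simps mult_left_mono)
    let ?y = "p + \<epsilon> *\<^sub>R h"
    have "0 \<le> (norm ?y - 1)\<^sup>2" by simp
    moreover have "(norm ?y)\<^sup>2 = 1 + 2 * \<epsilon> * (p \<bullet> h) + \<epsilon>\<^sup>2 * (norm h)\<^sup>2"
      unfolding power2_norm_eq_inner
      by (simp add: inner_add_left inner_add_right pp inner_commute power2_eq_square algebra_simps)
    ultimately have ny: "norm ?y \<le> 1 + \<epsilon> * (p \<bullet> h) + \<epsilon> * (\<epsilon> * (norm h)\<^sup>2) / 2"
      by (simp add: power2_eq_square algebra_simps)
    also have "\<dots> \<le> 1 + \<epsilon> * (p \<bullet> h) + \<epsilon> * g / 2"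
      using mult_left_mono[OF \<epsilon>(2), of \<epsilon>] \<epsilon>(1) by simp
    finally have "k * norm ?y \<le> k * (1 + \<epsilon> * (p \<bullet> h) + \<epsilon> * g / 2)"
      using k0 by (rule mult_left_mono)
    moreover have "k * (\<epsilon> * g / 2) \<le> \<epsilon> * g / 2"
      using k_bounds k0 \<epsilon> g by (intro mult_left_le_one_le) auto
    ultimately have kny: "k * norm ?y \<le> k + \<epsilon> * (k * (p \<bullet> h)) + \<epsilon> * (g / 2)"
      by (simp add: algebra_simps)
    have "k * norm ?y \<le> ?y \<bullet> v" if v: "v \<in> V" for v
      using kny mult_left_mono[OF slope[OF v], of \<epsilon>] \<epsilon>(1) diameter[OF p v]
      by (simp add: inner_add_left algebra_simps)
    moreover have neg: "c \<bullet> ?y < 0"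
    proof -
      have "c \<bullet> ?y = - \<epsilon> * \<eta>" using cp cc by (simp add: h_def inner_add_right inner_diff_right)
      then show ?thesis using \<epsilon>(1) g by (simp add: \<eta>_def)
    qed
    moreover from neg have y0: "?y \<noteq> 0" by auto
    ultimately have "sgn ?y \<in> V"
      by (intro mem_V_if_within_diameter[OF k0]) (auto simp: norm_sgn le_inner_sgn_iff)
    from U_V_nonneg[OF c this] neg y0 show False
      by (simp add: sgn_div_norm zero_le_mult_iff)
  qed
qed

text \<open>Two points \<open>a\<close>, \<open>b\<close> of \<open>U\<close> at maximal distance belong to the thinnest lune around \<open>V\<close>, and both
  centers of its bounding hemispheres lie in \<open>V\<close>. At the center \<open>p\<close> orthogonal to \<open>a\<close> there is a point of
  \<open>V\<close> at full distance; for \<open>0 \<le> k\<close> it can be taken in the plane of \<open>a\<close> and \<open>p\<close>. As this point lies in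
  the lune, the lune is not too thin.\<close>

lemma polar_diameter:
  assumes "c \<in> U" "c' \<in> U"
  shows "- k \<le> c \<bullet> c'"
proof -
  obtain a b where ab: "a \<in> U" "b \<in> U" "\<And>x y. x \<in> U \<Longrightarrow> y \<in> U \<Longrightarrow> a \<bullet> b \<le> x \<bullet> y"
    using polar_pair.exists_diametral_pair[OF flip] by metis
  obtain a' where a': "a' \<in> U" "a' \<bullet> b < 1" using polar_pair.exists_farthest[OF flip ab(2)] by metis
  have ab1: "a \<bullet> b < 1" using ab(3)[OF a'(1) ab(2)] a'(2) by simp
  \<comment> \<open>The boundary hemispheres of the lune given by \<open>a\<close> and \<open>b\<close> have centers in \<open>V\<close>; \<open>p\<close> is the one
    orthogonal to \<open>a\<close>.\<close>
  define s where "s = a \<bullet> b"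
  define p where "p = (b - s *\<^sub>R a) /\<^sub>R sqrt (1 - s\<^sup>2)"
  have p: "p \<in> V" "a \<bullet> p = 0"
    using polar_pair.farthest_normal[OF flip ab(1,2) ab1 ab(3)[OF _ ab(2)]]
    by (simp_all add: p_def s_def inner_commute)
  have as: "a \<in> sphere 0 1" and bs: "b \<in> sphere 0 1" and ps: "p \<in> sphere 0 1"
    using ab p polar_pair.V_sphere[OF flip] V_sphere by blast+
  have s: "-1 < s" "s < 1" "s\<^sup>2 < 1"
    using ab1 polar_pair.inner_gt_minus_1[OF flip ab(1,2)]
    by (simp_all add: s_def abs_square_less_1 abs_less_iff)
  let ?\<sigma> = "sqrt (1 - k\<^sup>2)" and ?\<tau> = "sqrt (1 - s\<^sup>2)"
  have \<tau>: "0 < ?\<tau>" and \<sigma>: "0 < ?\<sigma>" using s k_sq by simp_all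
  have pb: "p \<bullet> b = ?\<tau>"
  proof -
    have "p \<bullet> b = (1 - s\<^sup>2) / ?\<tau>"
      using inner_self_sphere[OF bs]
      by (simp add: p_def inner_diff_left s_def[symmetric] power2_eq_square inverse_eq_divide)
    then show ?thesis using s by (simp add: real_div_sqrt)
  qed
  have "- k \<le> s"
  proof (cases "0 \<le> k")
    case True
    have "k *\<^sub>R p + ?\<sigma> *\<^sub>R a \<in> V" using opposite_point_mem_V[OF True ab(1) p] .
    from U_V_nonneg[OF ab(2) this] have "0 \<le> k * ?\<tau> + ?\<sigma> * s"
      using pb by (simp add: inner_add_right inner_commute s_def)
    show ?thesis
    proof (rule ccontr)
      assume "\<not> - k \<le> s"
      then have less: "k < - s" by simp
      then have "k\<^sup>2 < s\<^sup>2" using True power_strict_mono[of k "- s" 2] by simp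
      then have "?\<tau> \<le> ?\<sigma>" by simp
      then have "k * ?\<tau> \<le> k * ?\<sigma>" using True by (rule mult_left_mono)
      moreover have "?\<sigma> * k < ?\<sigma> * - s" using less \<sigma> by (rule mult_strict_left_mono)
      ultimately show False using \<open>0 \<le> k * ?\<tau> + ?\<sigma> * s\<close> by (simp add: mult.commute)
    qed
  next
    case False
    \<comment> \<open>For \<open>k < 0\<close> a lune with \<open>s < - k\<close> would be too thin to hold a point \<open>q\<close> so far from \<open>p\<close>.\<close>
    obtain q where q: "q \<in> V" "p \<bullet> q = k" using partner[OF p(1) ab(1) p(2)] by blast
    have aq: "0 \<le> a \<bullet> q" and bq: "0 \<le> b \<bullet> q" using U_V_nonneg ab q by blast+
    have "b = s *\<^sub>R a + ?\<tau> *\<^sub>R p" using \<tau> by (simp add: p_def)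
    then have "b \<bullet> q = s * (a \<bullet> q) + ?\<tau> * k" using q(2) by (metis inner_add_left inner_scaleR_left)
    with bq have ineq: "?\<tau> * - k \<le> s * (a \<bullet> q)" by simp
    have aq1: "a \<bullet> q \<le> ?\<sigma>" using inner_normal_le[OF as ps V_sphere[OF q(1)] p(2)] q(2) by simp
    show ?thesis
    proof (rule ccontr)
      assume "\<not> - k \<le> s"
      then have less: "s < - k" by simp
      have "0 < ?\<tau> * - k" using \<tau> False by (intro mult_pos_pos) auto
      then have s0: "0 < s" using ineq aq by (smt (verit) mult_nonpos_nonneg)
      then have "s\<^sup>2 < k\<^sup>2" using less power_strict_mono[of s "- k" 2] by simp
      then have "?\<sigma> < ?\<tau>" by simp
      have "s * (a \<bullet> q) \<le> s * ?\<sigma>" using aq1 s0 by simp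
      also have "\<dots> < s * ?\<tau>" using \<open>?\<sigma> < ?\<tau>\<close> s0 by simp
      also have "\<dots> < - k * ?\<tau>" using less \<tau> by (rule mult_strict_right_mono)
      finally show False using ineq by (simp add: mult.commute)
    qed
  qed
  then show ?thesis using ab(3)[OF assms] by (simp add: s_def)
qed

text \<open>If \<open>p\<close>, \<open>q\<close> is a diametral pair, then the normal \<open>c'\<close> at \<open>q\<close> has
  \<open>c \<bullet> c' = - k * (c \<bullet> q) / sqrt (1 - k\<^sup>2)\<close>, where \<open>c \<bullet> q\<close> is at most \<open>sqrt (1 - k\<^sup>2)\<close>. For \<open>0 \<le> k\<close> a
  suitable choice of \<open>q\<close> makes it equal. For \<open>k < 0\<close> every \<open>q\<close> gives \<open>c \<bullet> c' \<le> - k\<close>, and the bound on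
  the diameter of \<open>U\<close> is the converse inequality.\<close>

lemma polar_partner:
  assumes c: "c \<in> U" and p: "p \<in> V" and cp: "c \<bullet> p = 0"
  shows "\<exists>c'\<in>U. c \<bullet> c' = - k"
proof -
  let ?\<sigma> = "sqrt (1 - k\<^sup>2)"
  have cs: "c \<in> sphere 0 1" and ps: "p \<in> sphere 0 1"
    using c p polar_pair.V_sphere[OF flip] V_sphere by blast+
  have \<sigma>: "0 < ?\<sigma>" using k_sq by simp
  have normal: "\<exists>c'\<in>U. c \<bullet> c' = - k * (c \<bullet> q) / ?\<sigma>" if q: "q \<in> V" "p \<bullet> q = k" for q
  proof
    show "(p - k *\<^sub>R q) /\<^sub>R ?\<sigma> \<in> U" using partner_normal[of q p] q p by (simp add: inner_commute)
    show "c \<bullet> ((p - k *\<^sub>R q) /\<^sub>R ?\<sigma>) = - k * (c \<bullet> q) / ?\<sigma>"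
      using cp by (simp add: inner_diff_right divide_inverse mult.commute)
  qed
  show ?thesis
  proof (cases "0 \<le> k")
    case True
    let ?q = "k *\<^sub>R p + ?\<sigma> *\<^sub>R c"
    have "?q \<in> V" using opposite_point_mem_V[OF True c p cp] .
    moreover have "p \<bullet> ?q = k" and cq: "c \<bullet> ?q = ?\<sigma>"
      using cp inner_self_sphere[OF cs] inner_self_sphere[OF ps]
      by (simp_all add: inner_add_right inner_commute)
    ultimately show ?thesis using normal[of ?q] \<sigma> unfolding cq by simp
  next
    case False
    obtain q where q: "q \<in> V" "p \<bullet> q = k" using partner[OF p c cp] by blast
    obtain c' where c': "c' \<in> U" "c \<bullet> c' = - k * (c \<bullet> q) / ?\<sigma>" using normal[OF q] by blast
    have "c \<bullet> q \<le> ?\<sigma>" using inner_normal_le[OF cs ps V_sphere[OF q(1)] cp] q(2) by simp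
    then have "- k * (c \<bullet> q) \<le> - k * ?\<sigma>" using False by (intro mult_left_mono) auto
    then have "- k * (c \<bullet> q) / ?\<sigma> \<le> - k" using \<sigma> by (simp only: pos_divide_le_eq)
    then have "c \<bullet> c' \<le> - k" using c'(2) by simp
    then show ?thesis using polar_diameter[OF c c'(1)] c'(1) by force
  qed
qed

lemma polar_constant_diameter: "constant_diameter_pair U V (- k)"
proof -
  interpret dual: polar_pair U V by (rule flip)
  show ?thesis
  proof
    show "\<And>c c'. c \<in> U \<Longrightarrow> c' \<in> U \<Longrightarrow> - k \<le> c \<bullet> c'" by (rule polar_diameter)
    show "\<And>c p. c \<in> U \<Longrightarrow> p \<in> V \<Longrightarrow> p \<bullet> c = 0 \<Longrightarrow> \<exists>c'\<in>U. c \<bullet> c' = - k"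
      using polar_partner by (simp add: inner_commute)
  qed
qed

end

section \<open>Spherical convex bodies as polar sets\<close>

lemma nonneg_combination_in_cone:
  assumes C: "sconvex C" and x: "x \<in> C" and y: "y \<in> C" and "0 \<le> s" "0 \<le> t" "0 < s + t"
  obtains u z where "0 < u" "z \<in> C" "s *\<^sub>R x + t *\<^sub>R y = u *\<^sub>R z"
proof -
  define m where "m = (s / (s + t)) *\<^sub>R x + (t / (s + t)) *\<^sub>R y"
  have eq: "s *\<^sub>R x + t *\<^sub>R y = (s + t) *\<^sub>R m" using assms(6) by (simp add: m_def scaleR_add_right)
  have "1 - t / (s + t) = s / (s + t)" using assms(6) by (simp add: field_simps)
  then have "m = (1 - t / (s + t)) *\<^sub>R x + (t / (s + t)) *\<^sub>R y" by (simp add: m_def)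
  moreover have "0 \<le> t / (s + t)" "t / (s + t) \<le> 1" using assms by simp_all
  ultimately have "m \<in> closed_segment x y" unfolding in_segment by blast
  then have "sgn m \<in> sarc x y" by (auto simp: sarc_def)
  then have z: "sgn m \<in> C" "C \<subseteq> sphere 0 1" using C x y unfolding sconvex_def by blast+
  then have "sgn m \<in> sphere 0 1" by blast
  then have m0: "m \<noteq> 0" by auto
  then have "s *\<^sub>R x + t *\<^sub>R y = ((s + t) * norm m) *\<^sub>R sgn m"
    unfolding eq by (simp add: sgn_div_norm)
  then show ?thesis using that[of "(s + t) * norm m" "sgn m"] z m0 assms(6) by simp
qed

lemma conic_hull_sconvex:
  assumes "sconvex C" "closed C"
  shows "convex (conic hull C)" "closed (conic hull C)"
proof -
  have "C \<subseteq> sphere 0 1" using assms by (simp add: sconvex_def)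
  then have "compact C" "0 \<notin> C"
    using assms(2) bounded_subset[OF bounded_sphere, of C 0 1] by (auto simp: compact_eq_bounded_closed)
  then show "closed (conic hull C)" by (intro closed_conic_hull) auto
  show "convex (conic hull C)"
  proof (rule convexI)
    fix x y and a b :: real
    assume "x \<in> conic hull C" "y \<in> conic hull C" and ab: "0 \<le> a" "0 \<le> b"
    then obtain s t p q where pq: "0 \<le> s" "p \<in> C" "x = s *\<^sub>R p" "0 \<le> t" "q \<in> C" "y = t *\<^sub>R q"
      by (auto simp: conic_hull_explicit)
    have nn: "0 \<le> a * s" "0 \<le> b * t" using ab pq by simp_all
    have eq: "a *\<^sub>R x + b *\<^sub>R y = (a * s) *\<^sub>R p + (b * t) *\<^sub>R q" using pq by simp
    show "a *\<^sub>R x + b *\<^sub>R y \<in> conic hull C"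
    proof (cases "a * s + b * t = 0")
      case True
      then have "a * s = 0" "b * t = 0" using nn by linarith+
      then have "a *\<^sub>R x + b *\<^sub>R y = 0" unfolding eq by (simp only: scaleR_zero_left add_0)
      moreover have "C \<noteq> {}" using pq(2) by blast
      ultimately show ?thesis by simp
    next
      case False
      then have "0 < a * s + b * t" using nn by linarith
      then obtain u z where "0 < u" "z \<in> C" "(a * s) *\<^sub>R p + (b * t) *\<^sub>R q = u *\<^sub>R z"
        using nonneg_combination_in_cone[OF assms(1) pq(2,5) nn] by blast
      then show ?thesis unfolding eq conic_hull_explicit using less_imp_le by blast
    qed
  qed
qed

text \<open>The cone over \<open>C\<close> is closed and convex, so a point outside is separated from it by a hyperplane through
  the origin.\<close>

lemma bipolar:
  assumes "sconvex C" "closed C" "C \<noteq> {}"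
  shows "polar (polar C) = C"
proof
  have Cs: "C \<subseteq> sphere 0 1" using assms by (simp add: sconvex_def)
  then show "C \<subseteq> polar (polar C)" by (auto simp: polar_def inner_commute)
  show "polar (polar C) \<subseteq> C"
  proof (rule subsetI, rule ccontr)
    fix y assume y: "y \<in> polar (polar C)" "y \<notin> C"
    have "y \<notin> conic hull C"
    proof
      assume "y \<in> conic hull C"
      then obtain t p where tp: "0 \<le> t" "p \<in> C" "y = t *\<^sub>R p" by (auto simp: conic_hull_explicit)
      then have "norm y = t" using Cs by auto
      then have "t = 1" using y(1) by (simp add: polar_def)
      then show False using y tp by simp
    qed
    with separating_hyperplane_closed_point[OF conic_hull_sconvex[OF assms(1,2)]]
    obtain a b where ab: "a \<bullet> y < b" "\<And>x. x \<in> conic hull C \<Longrightarrow> b < a \<bullet> x" by blast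
    have mem: "t *\<^sub>R x \<in> conic hull C" if "x \<in> C" "0 \<le> t" for x t
      using that by (auto simp: conic_hull_explicit)
    have b: "b < 0"
    proof -
      obtain x where "x \<in> C" using assms(3) by blast
      from ab(2)[OF mem[OF this, of 0]] show ?thesis by simp
    qed
    have nonneg: "0 \<le> a \<bullet> x" if "x \<in> C" for x
    proof (rule ccontr)
      assume neg: "\<not> 0 \<le> a \<bullet> x"
      \<comment> \<open>Scaled by this factor, \<open>x\<close> would lie on the separating hyperplane.\<close>
      then have "0 \<le> b / (a \<bullet> x)" using b by (simp add: divide_nonpos_nonpos)
      from ab(2)[OF mem[OF that this]] neg show False by simp
    qed
    have a0: "a \<noteq> 0" using ab(1) b by auto
    have "sgn a \<in> polar C" using a0 nonneg by (intro sgn_mem_polar) (auto simp: inner_commute)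
    then have "0 \<le> sgn a \<bullet> y" using y(1) by (auto simp: polar_def)
    moreover have "a \<bullet> y < 0" using ab b by simp
    ultimately show False using a0 by (simp add: sgn_div_norm zero_le_mult_iff)
  qed
qed

lemma strictly_positive_functional:
  assumes "sconvex C" "closed C" "C \<noteq> {}"
  obtains b where "b \<in> polar C" "\<And>x. x \<in> C \<Longrightarrow> 0 < x \<bullet> b"
proof -
  have Cs: "C \<subseteq> sphere 0 1" using assms by (simp add: sconvex_def)
  \<comment> \<open>The cone over \<open>C\<close> without its apex is convex, so the convex hull of \<open>C\<close> misses the origin.\<close>
  define P where "P = {u *\<^sub>R z | u z. 0 < u \<and> z \<in> C}"
  have "convex P"
  proof (rule convexI)
    fix x y and a b :: real
    assume "x \<in> P" "y \<in> P" and ab: "0 \<le> a" "0 \<le> b" "a + b = 1"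
    then obtain s t p q where pq: "0 < s" "p \<in> C" "x = s *\<^sub>R p" "0 < t" "q \<in> C" "y = t *\<^sub>R q"
      by (auto simp: P_def)
    have nn: "0 \<le> a * s" "0 \<le> b * t" using ab pq by simp_all
    have "0 < a \<or> 0 < b" using ab by linarith
    then have "0 < a * s + b * t" using nn pq by (meson add_pos_nonneg add_nonneg_pos mult_pos_pos)
    then obtain u z where "0 < u" "z \<in> C" "(a * s) *\<^sub>R p + (b * t) *\<^sub>R q = u *\<^sub>R z"
      using nonneg_combination_in_cone[OF assms(1) pq(2,5) nn] by blast
    then show "a *\<^sub>R x + b *\<^sub>R y \<in> P" using pq by (auto simp: P_def)
  qed
  moreover have "C \<subseteq> P" by (force simp: P_def intro: exI[of _ "1::real"])
  ultimately have "convex hull C \<subseteq> P" by (simp add: hull_minimal)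
  moreover have "0 \<notin> P" using Cs by (auto simp: P_def)
  ultimately have "0 \<notin> convex hull C" by blast
  moreover have "compact C"
    using assms(2) bounded_subset[OF bounded_sphere Cs] by (simp add: compact_eq_bounded_closed)
  then have "compact (convex hull C)" by (rule compact_convex_hull)
  ultimately obtain a b where ab: "a \<noteq> 0" "0 < b" "\<forall>x\<in>convex hull C. b < a \<bullet> x"
    using separating_hyperplane_closed_0[OF convex_convex_hull compact_imp_closed] by blast
  have pos: "0 < a \<bullet> x" if "x \<in> C" for x using ab hull_inc[OF that] by force
  show ?thesis
  proof (rule that)
    show "sgn a \<in> polar C"
      using ab(1) pos by (intro sgn_mem_polar) (auto simp: inner_commute less_imp_le)
    show "0 < x \<bullet> sgn a" if "x \<in> C" for x
      using pos[OF that] ab(1) by (simp add: sgn_div_norm inner_commute)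
  qed
qed

lemma frontier_of_sconvex_body:
  assumes "sconvex_body W"
  shows "sphere_top frontier_of W = {p \<in> W. \<exists>c\<in>polar W. c \<bullet> p = 0}"
    and "polar (polar W) = W" and "closed W"
proof -
  have W: "sconvex W" "closedin sphere_top W" "W \<noteq> {}"
    using assms by (auto simp: sconvex_body_def)
  show "closed W" using W(2) closedin_closed_trans[OF _ closed_sphere] by blast
  then show bip: "polar (polar W) = W" using bipolar W by blast
  show "sphere_top frontier_of W = {p \<in> W. \<exists>c\<in>polar W. c \<bullet> p = 0}"
    using frontier_of_polar[OF compact_polar[of W]] polar_sphere unfolding bip by blast
qed

lemma polar_pair_sconvex_body:
  fixes W :: "'a::euclidean_space set"
  assumes "sconvex_body W" "2 \<le> DIM('a)"
  shows "polar_pair W (polar W)"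
proof
  have W: "sconvex W" "sphere_top interior_of W \<noteq> {}"
    using assms(1) by (simp_all add: sconvex_body_def)
  show "W = polar (polar W)" using frontier_of_sconvex_body(2)[OF assms(1)] by simp
  obtain z where z: "z \<in> sphere_top interior_of W" using W(2) by blast
  have "z \<in> W" by (rule subsetD[OF interior_of_subset z])
  moreover have "z \<notin> sphere_top frontier_of W" using z by (simp add: frontier_of_def)
  ultimately have "c \<bullet> z \<noteq> 0" if "c \<in> polar W" for c
    using that frontier_of_sconvex_body(1)[OF assms(1)] by blast
  moreover have "0 \<le> c \<bullet> z" if "c \<in> polar W" for c
    using that \<open>z \<in> W\<close> by (auto simp: polar_def inner_commute)
  ultimately have "0 < c \<bullet> z" if "c \<in> polar W" for c
    using that by (simp add: less_le)
  then show "\<exists>z\<in>W. \<forall>c\<in>polar W. 0 < c \<bullet> z" using \<open>z \<in> W\<close> by blast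
  have "W \<noteq> {}" using \<open>z \<in> W\<close> by blast
  obtain b where "b \<in> polar W" "\<And>x. x \<in> W \<Longrightarrow> 0 < x \<bullet> b"
    using strictly_positive_functional[OF W(1) frontier_of_sconvex_body(3)[OF assms(1)] \<open>W \<noteq> {}\<close>]
    by blast
  then show "\<exists>b\<in>polar W. \<forall>x\<in>W. 0 < x \<bullet> b" by blast
  show "2 \<le> DIM('a)" by (rule assms(2))
qed (rule refl)

section \<open>Hemispheres and lunes\<close>

lemma sdist_le_half_pi_iff:
  assumes "c \<in> sphere 0 1" "x \<in> sphere 0 1"
  shows "sdist c x \<le> pi / 2 \<longleftrightarrow> 0 \<le> c \<bullet> x"
  using inner_le_1_sphere[OF assms] arccos_le_mono[of "c \<bullet> x" 0] by (simp add: sdist_def abs_le_iff)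

lemma hemisphere_at_eq_polar: "c \<in> sphere 0 1 \<Longrightarrow> hemisphere_at c = polar {c}"
  using sdist_le_half_pi_iff by (auto simp: hemisphere_at_def polar_def)

lemma frontier_of_hemisphere_at:
  assumes "c \<in> sphere 0 1"
  shows "sphere_top frontier_of (hemisphere_at c) = {x \<in> sphere 0 1. c \<bullet> x = 0}"
  unfolding hemisphere_at_eq_polar[OF assms]
  using assms by (subst frontier_of_polar) (auto simp: polar_def)

lemma hemisphere_at_inj:
  assumes c: "c \<in> sphere 0 1" "c' \<in> sphere 0 1" and eq: "hemisphere_at c = hemisphere_at c'"
  shows "c = c'"
proof (rule ccontr)
  assume "c \<noteq> c'"
  then have lt: "c \<bullet> c' < 1"
    using inner_eq_1_sphere[OF c] inner_le_1_sphere(1)[OF c] by force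
  let ?x = "c - c'"
  have cc: "c \<bullet> c = 1" "c' \<bullet> c' = 1" using c inner_self_sphere by blast+
  have "sgn ?x \<in> polar {c}"
    using \<open>c \<noteq> c'\<close> lt cc by (intro sgn_mem_polar) (auto simp: inner_diff_right)
  then have "0 \<le> c' \<bullet> sgn ?x" using eq hemisphere_at_eq_polar c by (auto simp: polar_def)
  then have "0 \<le> c' \<bullet> ?x" using \<open>c \<noteq> c'\<close> by (simp add: sgn_div_norm zero_le_mult_iff)
  then show False using lt cc by (simp add: inner_diff_right inner_commute)
qed

lemma forms_lune_hemisphere_at:
  assumes c: "c \<in> sphere 0 1" "c' \<in> sphere 0 1"
  shows "forms_lune (hemisphere_at c) (hemisphere_at c') \<longleftrightarrow> c' \<noteq> c \<and> c' \<noteq> - c"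
proof -
  have "opposite (hemisphere_at c) (hemisphere_at c') \<longleftrightarrow> c' = - c"
  proof
    assume "opposite (hemisphere_at c) (hemisphere_at c')"
    then obtain a where a: "a \<in> sphere 0 1" "hemisphere_at c = hemisphere_at a"
        "hemisphere_at c' = hemisphere_at (- a)" by (auto simp: opposite_def)
    have "c = a" "c' = - a" using a hemisphere_at_inj[of c a] hemisphere_at_inj[of c' "- a"] c by auto
    then show "c' = - c" by simp
  qed (use c in \<open>auto simp: opposite_def\<close>)
  then show ?thesis
    using c hemisphere_at_inj[OF c] by (auto simp: forms_lune_def hemisphere_def)
qed

text \<open>The center is determined by the set alone, whichever subspaces witness that it is a hemisphere.\<close>

lemma subhemisphere_center_unique:
  assumes a: "is_subhemisphere_at a X" and b: "is_subhemisphere_at b X"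
  shows "a = b"
proof -
  obtain S where S: "subspace S" "a \<in> sphere 0 1 \<inter> S"
      "X = {x \<in> sphere 0 1 \<inter> S. sdist a x \<le> pi / 2}"
    using a by (auto simp: is_subhemisphere_at_def)
  obtain T where T: "subspace T" "b \<in> sphere 0 1 \<inter> T"
      "X = {x \<in> sphere 0 1 \<inter> T. sdist b x \<le> pi / 2}"
    using b by (auto simp: is_subhemisphere_at_def)
  have XS: "x \<in> X \<longleftrightarrow> x \<in> sphere 0 1 \<and> x \<in> S \<and> 0 \<le> a \<bullet> x" for x
    using S sdist_le_half_pi_iff[of a x] by auto
  have XT: "x \<in> X \<longleftrightarrow> x \<in> sphere 0 1 \<and> x \<in> T \<and> 0 \<le> b \<bullet> x" for x
    using T sdist_le_half_pi_iff[of b x] by auto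
  have aa: "a \<bullet> a = 1" and bb: "b \<bullet> b = 1" using S T inner_self_sphere by blast+
  have "a \<in> X" using XS S aa by simp
  then have aT: "a \<in> T" and ba: "0 \<le> b \<bullet> a" using XT by blast+
  define r where "r = a - (b \<bullet> a) *\<^sub>R b"
  \<comment> \<open>Normalised, \<open>r\<close> and \<open>- r\<close> are antipodes in \<open>X\<close>, and antipodes in \<open>X\<close> are orthogonal to its center.\<close>
  have "a \<bullet> r = 0"
  proof (cases "r = 0")
    case False
    have br: "b \<bullet> r = 0" using bb by (simp add: r_def inner_diff_right)
    have "r \<in> T" using T(1,2) aT by (simp add: r_def subspace_diff subspace_scale)
    then have "sgn r \<in> X" "sgn (- r) \<in> X"
      using XT False br T(1) by (simp_all add: norm_sgn sgn_div_norm subspace_scale subspace_neg)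
    then have "0 \<le> a \<bullet> sgn r" "0 \<le> a \<bullet> sgn (- r)" using XS by blast+
    moreover have "a \<bullet> sgn (- r) = - (a \<bullet> sgn r)" by (simp add: sgn_minus)
    ultimately have "a \<bullet> sgn r = 0" by simp
    then show ?thesis using False by (simp add: sgn_div_norm)
  qed simp
  then have "1 = (b \<bullet> a)\<^sup>2"
    by (simp add: r_def inner_diff_right aa inner_commute power2_eq_square)
  then have "b \<bullet> a = 1" using ba by (simp add: power2_eq_1_iff)
  then show "a = b" using inner_eq_1_sphere[of b a] S T by simp
qed

lemma subhemisphere_center_lune:
  fixes c c' :: "'a::euclidean_space"
  assumes c: "c \<in> sphere 0 1" "c' \<in> sphere 0 1" and lt: "(c \<bullet> c')\<^sup>2 < 1"
  shows "subhemisphere_center (sphere_top frontier_of (hemisphere_at c) \<inter> hemisphere_at c') =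
           (c' - (c \<bullet> c') *\<^sub>R c) /\<^sub>R sqrt (1 - (c \<bullet> c')\<^sup>2)" (is "subhemisphere_center ?X = ?m")
proof -
  let ?\<sigma> = "sqrt (1 - (c \<bullet> c')\<^sup>2)"
  have cc: "c \<bullet> c = 1" "c' \<bullet> c' = 1" using c inner_self_sphere by blast+
  have \<sigma>: "0 < ?\<sigma>" using lt by simp
  have X: "?X = {x \<in> sphere 0 1. c \<bullet> x = 0 \<and> 0 \<le> c' \<bullet> x}"
    unfolding frontier_of_hemisphere_at[OF c(1)] hemisphere_at_eq_polar[OF c(2)]
    by (auto simp: polar_def)
  have n: "norm (c' - (c \<bullet> c') *\<^sub>R c) = ?\<sigma>"
    by (simp add: norm_eq_sqrt_inner inner_diff_left inner_diff_right cc inner_commute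
        power2_eq_square)
  have ms: "?m \<in> sphere 0 1" using n \<sigma> by simp
  have cm: "c \<bullet> ?m = 0" by (simp add: inner_diff_right cc)
  have "is_subhemisphere_at ?m ?X"
    unfolding is_subhemisphere_at_def
  proof (intro exI conjI)
    show "subspace {x. c \<bullet> x = 0}" by (rule subspace_hyperplane)
    have "c \<noteq> 0" using c by auto
    then have "dim {x. c \<bullet> x = 0} = DIM('a) - 1" by (rule dim_hyperplane)
    then show "dim {x. c \<bullet> x = 0} + 1 = DIM('a)" using DIM_positive[where 'a='a] by simp
    show "?m \<in> sphere 0 1 \<inter> {x. c \<bullet> x = 0}" using ms cm by blast
    have "sdist ?m x \<le> pi / 2 \<longleftrightarrow> 0 \<le> c' \<bullet> x" if "x \<in> sphere 0 1" "c \<bullet> x = 0" for x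
    proof -
      have "?m \<bullet> x = (c' \<bullet> x) / ?\<sigma>"
        using that by (simp add: inner_diff_left divide_inverse mult.commute)
      then show ?thesis using sdist_le_half_pi_iff[OF ms that(1)] \<sigma> by (simp add: zero_le_divide_iff)
    qed
    then show "?X = {x \<in> sphere 0 1 \<inter> {x. c \<bullet> x = 0}. sdist ?m x \<le> pi / 2}"
      unfolding X by blast
  qed
  then show ?thesis unfolding subhemisphere_center_def
    using subhemisphere_center_unique by (intro the_equality) blast+
qed

text \<open>In the plane of \<open>c\<close> and \<open>c'\<close> the two centers arise from \<open>c\<close> and \<open>c'\<close> by quarter turns in opposite senses,
  so their distance is \<open>pi\<close> minus the distance of \<open>c\<close> and \<open>c'\<close>.\<close>

lemma lune_thickness_hemisphere_at:
  fixes c c' :: "'a::euclidean_space"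
  assumes c: "c \<in> sphere 0 1" "c' \<in> sphere 0 1" and lt: "(c \<bullet> c')\<^sup>2 < 1"
  shows "lune_thickness (hemisphere_at c) (hemisphere_at c') = arccos (- (c \<bullet> c'))"
proof -
  define s where "s = c \<bullet> c'"
  have cc: "c \<bullet> c = 1" "c' \<bullet> c' = 1" using c inner_self_sphere by blast+
  have s: "s\<^sup>2 < 1" using lt by (simp add: s_def)
  have "((c' - s *\<^sub>R c) \<bullet> (c - s *\<^sub>R c')) = - s * (1 - s\<^sup>2)"
    using cc by (simp add: inner_diff_left inner_diff_right inner_commute s_def[symmetric]
        power2_eq_square algebra_simps)
  moreover have "inverse (sqrt (1 - s\<^sup>2)) * inverse (sqrt (1 - s\<^sup>2)) * (1 - s\<^sup>2) = 1"
    using s by (simp add: inverse_mult_distrib[symmetric] del: inverse_mult_distrib)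
  ultimately have "((c' - s *\<^sub>R c) /\<^sub>R sqrt (1 - s\<^sup>2)) \<bullet> ((c - s *\<^sub>R c') /\<^sub>R sqrt (1 - s\<^sup>2)) = - s"
    by (simp only: inner_scaleR_left inner_scaleR_right) (metis mult.assoc mult.commute mult_1)
  then show ?thesis
    unfolding lune_thickness_def sdist_def
    using subhemisphere_center_lune[OF c lt] subhemisphere_center_lune[OF c(2,1)] lt
    by (simp add: s_def inner_commute)
qed

section \<open>Width and diameter in terms of the polar set\<close>

lemma supports_iff:
  assumes "sconvex_body W"
  shows "supports K W \<longleftrightarrow> (\<exists>c\<in>polar W. K = hemisphere_at c \<and> (\<exists>p\<in>W. c \<bullet> p = 0))"
proof
  have Ws: "W \<subseteq> sphere 0 1" using assms by (simp add: sconvex_body_def sconvex_def)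
  note frW = frontier_of_sconvex_body(1)[OF assms]
  {
    assume "supports K W"
    then obtain c p where c: "c \<in> sphere 0 1" "K = hemisphere_at c" "W \<subseteq> hemisphere_at c"
        "p \<in> sphere_top frontier_of W" "p \<in> sphere_top frontier_of (hemisphere_at c)"
      unfolding supports_def hemisphere_def by blast
    then have "c \<in> polar W" by (auto simp: hemisphere_at_eq_polar polar_def inner_commute)
    moreover have "p \<in> W" "c \<bullet> p = 0" using c frontier_of_hemisphere_at[OF c(1)] frW by auto
    ultimately show "\<exists>c\<in>polar W. K = hemisphere_at c \<and> (\<exists>p\<in>W. c \<bullet> p = 0)" using c by blast
  }
  {
    assume "\<exists>c\<in>polar W. K = hemisphere_at c \<and> (\<exists>p\<in>W. c \<bullet> p = 0)"
    then obtain c p where c: "c \<in> polar W" "K = hemisphere_at c" "p \<in> W" "c \<bullet> p = 0" by blast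
    have cs: "c \<in> sphere 0 1" using c polar_sphere by blast
    have sub: "W \<subseteq> hemisphere_at c"
      using c(1) Ws by (auto simp: hemisphere_at_eq_polar[OF cs] polar_def inner_commute)
    have "p \<in> sphere_top frontier_of W" using frW c by blast
    moreover have "p \<in> sphere_top frontier_of (hemisphere_at c)"
      using frontier_of_hemisphere_at[OF cs] c Ws by auto
    ultimately show "supports K W" using c cs sub by (auto simp: supports_def hemisphere_def)
  }
qed

text \<open>The thinnest lune belongs to the point \<open>c'\<close> of the polar set farthest from \<open>c\<close>. Being farthest, it lies on
  the boundary of the polar set, that is, its hemisphere supports \<open>W\<close>. Thus the minimum over supporting
  hemispheres in the definition of width is attained.\<close>

lemma swidth_eq:
  fixes W :: "'a::euclidean_space set"
  assumes W: "sconvex_body W" "2 \<le> DIM('a)" and c: "c \<in> polar W" "p \<in> W" "c \<bullet> p = 0"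
  obtains c' where "c' \<in> polar W" "\<And>x. x \<in> polar W \<Longrightarrow> c' \<bullet> c \<le> x \<bullet> c"
    "swidth (hemisphere_at c) W = arccos (- (c' \<bullet> c))"
proof -
  interpret polar_pair W "polar W" by (rule polar_pair_sconvex_body[OF W])
  interpret dual: polar_pair "polar W" W by (rule flip)
  obtain c' where c': "c' \<in> polar W" "\<And>x. x \<in> polar W \<Longrightarrow> c' \<bullet> c \<le> x \<bullet> c" "c' \<bullet> c < 1"
    using dual.exists_farthest[OF c(1)] by blast
  have sph: "x \<in> sphere 0 1" if "x \<in> polar W" for x using that polar_sphere by blast
  have lune: "lune_thickness (hemisphere_at c) (hemisphere_at x) = arccos (- (x \<bullet> c))"
    "forms_lune (hemisphere_at c) (hemisphere_at x)"
    if x: "x \<in> polar W" "x \<noteq> c" for x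
  proof -
    have "-1 < x \<bullet> c" "x \<bullet> c < 1"
      using dual.inner_gt_minus_1[OF x(1) c(1)] dual.inner_lt_1[OF x(1) c(1) x(2)] by auto
    then have "(c \<bullet> x)\<^sup>2 < 1" by (simp add: inner_commute abs_square_less_1 abs_less_iff)
    then show "lune_thickness (hemisphere_at c) (hemisphere_at x) = arccos (- (x \<bullet> c))"
      using lune_thickness_hemisphere_at[OF sph[OF c(1)] sph[OF x(1)]] by (simp add: inner_commute)
    have "x \<noteq> - c" using \<open>-1 < x \<bullet> c\<close> inner_self_sphere[OF sph[OF c(1)]] by auto
    then show "forms_lune (hemisphere_at c) (hemisphere_at x)"
      using forms_lune_hemisphere_at[OF sph[OF c(1)] sph[OF x(1)]] x(2) by blast
  qed
  have "swidth (hemisphere_at c) W = arccos (- (c' \<bullet> c))"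
    unfolding swidth_def
  proof (rule Least_equality)
    have "c' \<noteq> c" using c'(3) inner_self_sphere[OF sph[OF c(1)]] by auto
    moreover have "supports (hemisphere_at c') W"
      unfolding supports_iff[OF W(1)]
      using dual.farthest_normal[OF c'(1) c(1) c'(3,2)] c'(1) by (metis inner_commute)
    ultimately show "\<exists>K'. supports K' W \<and> forms_lune (hemisphere_at c) K' \<and>
        arccos (- (c' \<bullet> c)) = lune_thickness (hemisphere_at c) K'"
      using lune[OF c'(1)] by metis
  next
    fix t assume "\<exists>K'. supports K' W \<and> forms_lune (hemisphere_at c) K' \<and>
        t = lune_thickness (hemisphere_at c) K'"
    then obtain x where x: "x \<in> polar W" "forms_lune (hemisphere_at c) (hemisphere_at x)"
        "t = lune_thickness (hemisphere_at c) (hemisphere_at x)"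
      by (auto simp: supports_iff[OF W(1)])
    then have "x \<noteq> c" by (auto simp: forms_lune_def)
    then have t: "t = arccos (- (x \<bullet> c))" using lune[OF x(1)] x(3) by simp
    show "arccos (- (c' \<bullet> c)) \<le> t" unfolding t
      using c'(2)[OF x(1)] inner_le_1_sphere[OF sph sph] c'(1) c(1) x(1)
      by (subst arccos_le_mono) (auto simp: abs_le_iff)
  qed
  then show ?thesis using that c' by blast
qed

lemma constant_diameter_iff:
  fixes W :: "'a::euclidean_space set"
  assumes W: "sconvex_body W" "2 \<le> DIM('a)"
  shows "constant_diameter W w \<longleftrightarrow>
    0 \<le> w \<and> w \<le> pi \<and> constant_diameter_pair W (polar W) (cos w)"
proof -
  interpret polar_pair W "polar W" by (rule polar_pair_sconvex_body[OF W])
  interpret dual: polar_pair "polar W" W by (rule flip)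
  note fr = frontier_of_sconvex_body(1)[OF W(1)]
  have bnd: "\<bar>x \<bullet> y\<bar> \<le> 1" if "x \<in> W" "y \<in> W" for x y
    using inner_le_1_sphere[OF that[THEN V_sphere]] by (simp add: abs_le_iff)
  obtain c p where cp: "c \<in> polar W" "p \<in> W" "c \<bullet> p = 0"
  proof -
    obtain x where x: "x \<in> W" using V_interior by blast
    obtain a where "a \<in> W" "\<And>y. y \<in> W \<Longrightarrow> a \<bullet> x \<le> y \<bullet> x" "a \<bullet> x < 1"
      using exists_farthest[OF x] by blast
    then show thesis using farthest_normal[of a x] x that by blast
  qed
  have sdist_eq: "sdist x y = w \<longleftrightarrow> 0 \<le> w \<and> w \<le> pi \<and> x \<bullet> y = cos w" if "x \<in> W" "y \<in> W" for x y
    using bnd[OF that] by (auto simp: sdist_def arccos_cos abs_le_iff arccos_lbound arccos_ubound)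
  have bdd: "bdd_above ((\<lambda>(a, b). sdist a b) ` (W \<times> W))"
    using bnd by (intro bdd_aboveI2[of _ _ pi]) (auto simp: sdist_def abs_le_iff intro!: arccos_ubound)
  show ?thesis
  proof
    assume cd: "constant_diameter W w"
    have partner: "\<exists>q\<in>W. sdist p q = w" if "p \<in> W" "c \<in> polar W" "c \<bullet> p = 0" for p c
      using cd that fr by (auto simp: constant_diameter_def)
    then have w: "0 \<le> w" "w \<le> pi" using cp sdist_eq by blast+
    have "cos w \<le> x \<bullet> y" if xy: "x \<in> W" "y \<in> W" for x y
    proof -
      have "sdist x y \<le> w"
        using cd cSUP_upper[OF _ bdd, of "(x, y)"] xy
        by (auto simp: constant_diameter_def sdiameter_def)
      then have "arccos (x \<bullet> y) \<le> arccos (cos w)" using w by (simp add: sdist_def arccos_cos)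
      then show ?thesis using bnd[OF xy] by (subst (asm) arccos_le_mono) auto
    qed
    moreover have "\<exists>q\<in>W. p \<bullet> q = cos w" if "p \<in> W" "c \<in> polar W" "c \<bullet> p = 0" for p c
      using partner[OF that] sdist_eq that(1) by blast
    ultimately have "constant_diameter_pair W (polar W) (cos w)" by unfold_locales
    then show "0 \<le> w \<and> w \<le> pi \<and> constant_diameter_pair W (polar W) (cos w)" using w by blast
  next
    assume r: "0 \<le> w \<and> w \<le> pi \<and> constant_diameter_pair W (polar W) (cos w)"
    then have w: "0 \<le> w" "w \<le> pi" by auto
    interpret constant_diameter_pair W "polar W" "cos w" using r by blast
    have partner': "\<exists>q\<in>W. sdist p q = w" if "p \<in> W" "c \<in> polar W" "c \<bullet> p = 0" for p c
      using partner[OF that] sdist_eq that(1) w by blast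
    then obtain q where q: "q \<in> W" "sdist p q = w" using cp by blast
    have "sdist x y \<le> w" if "x \<in> W" "y \<in> W" for x y
    proof -
      have "arccos (x \<bullet> y) \<le> arccos (cos w)"
        using diameter[OF that] bnd[OF that] by (subst arccos_le_mono) auto
      then show ?thesis using w by (simp add: sdist_def arccos_cos)
    qed
    then have "sdiameter W = w"
      unfolding sdiameter_def using q cp(2)
      by (intro cSup_eq_maximum) (auto intro: image_eqI[of _ _ "(p, q)"])
    then show "constant_diameter W w"
      using W(1) partner' fr by (auto simp: constant_diameter_def)
  qed
qed

text \<open>Width at \<open>c\<close> is \<open>pi\<close> minus the distance from \<open>c\<close> to a farthest point of the polar set, so constant
  width \<open>w\<close> means that the polar set has constant diameter \<open>pi - w\<close>, whose cosine is \<open>- cos w\<close>.\<close>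

lemma constant_width_iff:
  fixes W :: "'a::euclidean_space set"
  assumes W: "sconvex_body W" "2 \<le> DIM('a)"
  shows "constant_width W w \<longleftrightarrow>
    0 \<le> w \<and> w \<le> pi \<and> constant_diameter_pair (polar W) W (- cos w)"
proof -
  interpret polar_pair W "polar W" by (rule polar_pair_sconvex_body[OF W])
  interpret dual: polar_pair "polar W" W by (rule flip)
  have bnd: "\<bar>x \<bullet> y\<bar> \<le> 1" if "x \<in> polar W" "y \<in> polar W" for x y
    using inner_le_1_sphere[OF that[THEN U_sphere]] by (simp add: abs_le_iff)
  show ?thesis
  proof
    assume cw: "constant_width W w"
    have far: "\<exists>c'\<in>polar W. 0 \<le> w \<and> w \<le> pi \<and> c \<bullet> c' = - cos w \<and> (\<forall>x\<in>polar W. - cos w \<le> x \<bullet> c)"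
      if cp: "c \<in> polar W" "p \<in> W" "c \<bullet> p = 0" for c p
    proof -
      obtain c' where c': "c' \<in> polar W" "\<And>x. x \<in> polar W \<Longrightarrow> c' \<bullet> c \<le> x \<bullet> c"
        "swidth (hemisphere_at c) W = arccos (- (c' \<bullet> c))"
        using swidth_eq[OF W cp] by blast
      have "supports (hemisphere_at c) W" using supports_iff[OF W(1)] cp by blast
      then have w: "w = arccos (- (c' \<bullet> c))" using cw c'(3) by (simp add: constant_width_def)
      have b: "\<bar>c' \<bullet> c\<bar> \<le> 1" using bnd[OF c'(1) cp(1)] .
      then have "cos w = - (c' \<bullet> c)" unfolding w by (intro cos_arccos) auto
      moreover have "0 \<le> w" "w \<le> pi" unfolding w using b by (auto intro!: arccos_lbound arccos_ubound)
      ultimately show ?thesis using c'(1,2) by (intro bexI[of _ c']) (auto simp: inner_commute)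
    qed
    \<comment> \<open>Constant width speaks only of boundary points of the polar set. This suffices for its diameter,
      since two points at maximal distance are boundary points.\<close>
    obtain a b where ab: "a \<in> polar W" "b \<in> polar W"
      "\<And>x y. x \<in> polar W \<Longrightarrow> y \<in> polar W \<Longrightarrow> a \<bullet> b \<le> x \<bullet> y"
      using dual.exists_diametral_pair by blast
    obtain a' where "a' \<in> polar W" "a' \<bullet> b < 1" using dual.exists_farthest[OF ab(2)] by blast
    then have "a \<bullet> b < 1" using ab(3)[of a' b] ab(2) by simp
    from dual.farthest_normal[OF ab(1,2) this ab(3)[OF _ ab(2)]]
    obtain p where p: "p \<in> W" "a \<bullet> p = 0" by (metis inner_commute)
    have w: "0 \<le> w" "w \<le> pi" using far[OF ab(1) p] by blast+
    have "- cos w \<le> b \<bullet> a" using far[OF ab(1) p] ab(2) by blast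
    then have "- cos w \<le> x \<bullet> y" if "x \<in> polar W" "y \<in> polar W" for x y
      using ab(3)[OF that] by (simp add: inner_commute)
    moreover have "\<exists>c'\<in>polar W. c \<bullet> c' = - cos w" if "c \<in> polar W" "p \<in> W" "p \<bullet> c = 0" for c p
      using far[OF that(1,2)] that(3) by (auto simp: inner_commute)
    ultimately have "constant_diameter_pair (polar W) W (- cos w)" by unfold_locales
    then show "0 \<le> w \<and> w \<le> pi \<and> constant_diameter_pair (polar W) W (- cos w)" using w by blast
  next
    assume r: "0 \<le> w \<and> w \<le> pi \<and> constant_diameter_pair (polar W) W (- cos w)"
    interpret constant_diameter_pair "polar W" W "- cos w" using r by blast
    have "swidth K W = w" if supp: "supports K W" for K
    proof -
      obtain c p where cp: "c \<in> polar W" "p \<in> W" "c \<bullet> p = 0" and K: "K = hemisphere_at c"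
        using supp unfolding supports_iff[OF W(1)] by blast
      obtain c' where c': "c' \<in> polar W" "\<And>x. x \<in> polar W \<Longrightarrow> c' \<bullet> c \<le> x \<bullet> c"
        "swidth (hemisphere_at c) W = arccos (- (c' \<bullet> c))"
        using swidth_eq[OF W cp] by blast
      obtain q where "q \<in> polar W" "c \<bullet> q = - cos w"
        using partner[OF cp(1,2)] cp(3) by (auto simp: inner_commute)
      then have "c' \<bullet> c = - cos w"
        using c'(2)[of q] diameter[OF c'(1) cp(1)] by (simp add: inner_commute)
      then show ?thesis using c'(3) r K by (simp add: arccos_cos)
    qed
    then show "constant_width W w" using W(1) by (simp add: constant_width_def)
  qed
qed

theorem theorem3p7:
  fixes W :: "'a::euclidean_space set" and w :: real and d :: nat
  assumes "d \<ge> 2" and "DIM('a) = d + 1"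
  shows "(constant_width W w \<longrightarrow> constant_diameter W w) \<and>
         (constant_diameter W w \<and> w \<ge> pi / 2 \<longrightarrow> constant_width W w)"
proof (cases "sconvex_body W")
  case True
  have dim: "2 \<le> DIM('a)" using assms by simp
  have "constant_diameter_pair W (polar W) (cos w)"
    if "constant_diameter_pair (polar W) W (- cos w)"
    using constant_diameter_pair.polar_constant_diameter[OF that] by simp
  moreover have "constant_diameter_pair (polar W) W (- cos w)"
    if "constant_diameter_pair W (polar W) (cos w)"
    by (rule constant_diameter_pair.polar_constant_diameter[OF that])
  ultimately show ?thesis
    unfolding constant_diameter_iff[OF True dim] constant_width_iff[OF True dim] by blast
next
  case False
  then show ?thesis by (simp add: constant_width_def constant_diameter_def)
qed

end
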